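(* Let $p\ge2$. For every finite Borel measure $\mu$ on $\mathbb S^{p-1}$, write $M_\mu=\mu(\mathbb S^{p-1})$. Then for every $u\in\mathbb S^{p-1}$, with extended values allowed, $$I_\mu(u)=M_\mu+\int_0^1\frac{b_\mu(u,t)}{t^2}\,\mathrm dt .$$ If $$W_\mu(u):=\sum_{n=0}^\infty 2^n\,b_\mu(u,2^{-n}),$$ then $$\frac{W_\mu(u)+M_\mu}{2}\le I_\mu(u)\le W_\mu(u)+M_\mu .$$ In particular, $I_\mu(u)<\infty$ for Haar-almost every $u$ if and only if $W_\mu(u)<\infty$ for Haar-almost every $u$.
   Context: For $u\in\mathbb S^{p-1}$, $I_\mu(u):=\int_{\mathbb S^{p-1}}\frac1{|a^\top u|}\,\mu(\mathrm da)\in[0,\infty]$, with integrand $+\infty$ when $a^\top u=0$. For $0<t\le1$, $b_\mu(u,t):=\mu\{a\in\mathbb S^{p-1}:|a^\top u|\le t\}$. *)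

theory Defs
  imports "HOL-Analysis.Analysis" "HOL-Probability.Probability"
begin

abbreviation unit_sphere :: "(real ^ 'p) set" where
  "unit_sphere \<equiv> sphere 0 1"

definition finite_borel_measure_on_sphere :: "(real ^ 'p) measure \<Rightarrow> bool" where
  "finite_borel_measure_on_sphere \<mu> \<longleftrightarrow>
     sets \<mu> = sets (restrict_space borel unit_sphere) \<and> finite_measure \<mu>"

definition I_int :: "(real ^ 'p) measure \<Rightarrow> real ^ 'p \<Rightarrow> ennreal" where
  "I_int \<mu> u = (\<integral>\<^sup>+ a. (if a \<bullet> u = 0 then \<infinity> else ennreal (1 / \<bar>a \<bullet> u\<bar>)) \<partial>\<mu>)"

definition band :: "(real ^ 'p) measure \<Rightarrow> real ^ 'p \<Rightarrow> real \<Rightarrow> ennreal" where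
  "band \<mu> u t = emeasure \<mu> {a \<in> unit_sphere. \<bar>a \<bullet> u\<bar> \<le> t}"

definition W_sum :: "(real ^ 'p) measure \<Rightarrow> real ^ 'p \<Rightarrow> ennreal" where
  "W_sum \<mu> u = (\<Sum>n. 2 ^ n * band \<mu> u (1 / 2 ^ n))"

text \<open>
  The Haar measure of the sphere is the unique Borel probability measure on it that is
  invariant under the orthogonal group. Its existence is proved below, so a statement
  about every such \<open>\<sigma>\<close> is not vacuous.
\<close>

definition sphere_haar_measure :: "(real ^ 'p) measure \<Rightarrow> bool" where
  "sphere_haar_measure \<sigma> \<longleftrightarrow>
     sets \<sigma> = sets (restrict_space borel unit_sphere) \<and> prob_space \<sigma> \<and>
     (\<forall>f. orthogonal_transformation f \<longrightarrow> distr \<sigma> \<sigma> f = \<sigma>)"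

lemma vimage_ball_orthogonal:
  fixes f :: "'a::euclidean_space \<Rightarrow> 'a"
  assumes f: "orthogonal_transformation f"
  shows "f -` ball a r = ball (inv f a) r"
proof -
  have "dist a (f x) = dist (inv f a) x" for x
    using f by (metis bij_inv_eq_iff orthogonal_transformation_bij orthogonal_transformation_isometry)
  thus ?thesis by auto
qed

lemma distr_lborel_orthogonal:
  fixes f :: "'a::euclidean_space \<Rightarrow> 'a"
  assumes f: "orthogonal_transformation f"
  shows "distr lborel borel f = lborel"
proof (rule sym, rule lborel_eqI)
  have lin: "linear f" using f by (rule orthogonal_transformation_linear)
  have bij: "bij f" using f by (rule orthogonal_transformation_bij)
  have fm [measurable]: "f \<in> borel_measurable borel"
    using lin by (intro borel_measurable_continuous_onI linear_continuous_on) (simp add: linear_conv_bounded_linear)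
  have g: "orthogonal_transformation (inv f)"
    using f by (rule orthogonal_transformation_inv)
  show "emeasure (distr lborel borel f) (box l u) = (\<Prod>b\<in>Basis. (u - l) \<bullet> b)"
    if lu: "\<And>b. b \<in> Basis \<Longrightarrow> l \<bullet> b \<le> u \<bullet> b" for l u :: 'a
  proof -
    let ?U = "box l u"
    let ?K = "{(a, r). 0 < r \<and> ball a r \<subseteq> ?U}"
    have "\<exists>i. i \<in> ?K \<and> x \<in> ball (fst i) (snd i) \<and> snd i < d" if x: "x \<in> ?U" and d: "0 < d" for x d
    proof -
      obtain e where e: "e > 0" "ball x e \<subseteq> ?U"
        using x open_box open_contains_ball by blast
      have "ball x (min e (d/2)) \<subseteq> ?U" using e by auto
      then show ?thesis using e d by (intro exI[of _ "(x, min e (d/2))"]) auto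
    qed
    from Vitali_covering_theorem_balls[of ?U ?K fst snd, OF this]
    obtain C where C: "countable C" "C \<subseteq> ?K"
        and dj: "pairwise (\<lambda>i j. disjnt (ball (fst i) (snd i)) (ball (fst j) (snd j))) C"
        and ne: "negligible (?U - (\<Union>i \<in> C. ball (fst i) (snd i)))" (is "negligible ?Z")
      by blast
    let ?B = "\<lambda>i. ball (fst i) (snd i)"
    have Zb: "?Z \<in> sets borel" using C(1) by (intro sets.Diff sets.countable_UN') auto
    have Z0: "emeasure lborel ?Z = 0"
      using ne Zb by (simp add: negligible_iff_null_sets null_sets_def)
    have fZ: "f -` ?Z = inv f ` ?Z" using bij by (simp add: bij_vimage_eq_inv_image)
    have "negligible (inv f ` ?Z)"
    proof (rule negligible_differentiable_image_negligible[OF _ ne])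
      show "inv f differentiable_on ?Z"
        using orthogonal_transformation_linear[OF g] by (rule linear_imp_differentiable_on)
    qed simp
    moreover have fZb: "f -` ?Z \<in> sets borel" using measurable_sets[OF fm Zb] by simp
    ultimately have fZ0: "emeasure lborel (f -` ?Z) = 0"
      using fZ by (simp add: negligible_iff_null_sets null_sets_def)
    have U: "?U = (\<Union>i\<in>C. ?B i) \<union> ?Z" using C(2) by (fastforce simp del: mem_ball)
    have fU: "f -` ?U = (\<Union>i\<in>C. f -` ?B i) \<union> f -` ?Z" by (subst U) auto
    have BB: "emeasure lborel (f -` ?B i) = emeasure lborel (?B i)" if "i \<in> C" for i
      using that C(2) by (auto simp: vimage_ball_orthogonal[OF f] emeasure_ball)
    have fBb: "f -` ?B i \<in> sets borel" for i
      using measurable_sets[OF fm, of "?B i"] by simp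
    have d1: "disjoint_family_on ?B C"
      using dj unfolding disjoint_family_on_def pairwise_def disjnt_def by blast
    have d2: "disjoint_family_on (\<lambda>i. f -` ?B i) C"
      using d1 unfolding disjoint_family_on_def by blast
    have "emeasure lborel (f -` ?U) = emeasure lborel (\<Union>i\<in>C. f -` ?B i)"
      unfolding fU using C(1) fZ0 fZb fBb
      by (intro emeasure_Un_null_set) (auto simp: null_sets_def intro!: sets.countable_UN')
    also have "\<dots> = (\<integral>\<^sup>+i. emeasure lborel (f -` ?B i) \<partial>count_space C)"
      using C(1) d2 fBb by (intro emeasure_UN_countable) auto
    also have "\<dots> = (\<integral>\<^sup>+i. emeasure lborel (?B i) \<partial>count_space C)"
      using BB by (intro nn_integral_cong) auto
    also have "\<dots> = emeasure lborel (\<Union>i\<in>C. ?B i)"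
      using C(1) d1 by (intro emeasure_UN_countable[symmetric]) auto
    also have "\<dots> = emeasure lborel ((\<Union>i\<in>C. ?B i) \<union> ?Z)"
      using C(1) Z0 Zb
      by (intro emeasure_Un_null_set[symmetric]) (auto simp: null_sets_def intro!: sets.countable_UN')
    also have "\<dots> = emeasure lborel ?U" using U by simp
    finally show ?thesis using lu by (simp add: emeasure_distr emeasure_lborel_box)
  qed
qed simp

text \<open>The radial projection of the uniform distribution on the unit ball is a Haar measure.\<close>

lemma sphere_haar_measure_exists: "\<exists>\<sigma> :: (real ^ 'p) measure. sphere_haar_measure \<sigma>"
proof -
  let ?S = "unit_sphere :: (real ^ 'p) set"
  let ?R = "restrict_space borel ?S"
  let ?B = "ball (0 :: real ^ 'p) 1"
  define N where "N = uniform_measure lborel ?B"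
  obtain e :: "real ^ 'p" where e: "norm e = 1" using vector_choose_size[of 1] by auto
  define h where "h = (\<lambda>x :: real ^ 'p. if x = 0 then e else x /\<^sub>R norm x)"
  have hm: "h \<in> measurable borel ?R"
    unfolding h_def by (rule measurable_restrict_space2) (use e in auto)
  have sN [simp]: "sets N = sets borel" "space N = UNIV" by (auto simp: N_def)
  have hN [measurable]: "h \<in> measurable N ?R" using hm measurable_cong_sets[OF sN(1) refl] by blast
  have B: "emeasure lborel ?B \<noteq> 0" "emeasure lborel ?B \<noteq> \<infinity>"
    using emeasure_lborel_ball_finite[of "0 :: real ^ 'p" 1]
    using unit_ball_vol_pos[of "real CARD('p)"] by (auto simp: emeasure_ball simp del: unit_ball_vol_pos)
  interpret N: prob_space N unfolding N_def by (rule prob_space_uniform_measure[OF B])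
  define \<sigma> where "\<sigma> = distr N ?R h"
  have "distr \<sigma> \<sigma> f = \<sigma>" if f: "orthogonal_transformation f" for f
  proof -
    have fl: "linear f" using f by (rule orthogonal_transformation_linear)
    have fm [measurable]: "f \<in> borel_measurable borel"
      using fl by (intro borel_measurable_continuous_onI linear_continuous_on) (simp add: linear_conv_bounded_linear)
    have nf: "norm (f x) = norm x" for x using f by (simp add: orthogonal_transformation_norm)
    have fR [measurable]: "f \<in> measurable ?R ?R"
      by (rule measurable_restrict_space3[OF fm]) (auto simp: nf)
    have NN: "distr N N f = N"
    proof (rule measure_eqI)
      fix A assume "A \<in> sets (distr N N f)"
      then have A: "A \<in> sets borel" by simp
      have "emeasure (distr N N f) A = emeasure N (f -` A)"
        using A by (subst emeasure_distr) (auto simp: measurable_cong_sets[OF sN(1) sN(1)])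
      also have "\<dots> = emeasure lborel (?B \<inter> f -` A) / emeasure lborel ?B"
        using A measurable_sets[OF fm A] by (simp add: N_def)
      also have "?B \<inter> f -` A = f -` (?B \<inter> A)" by (auto simp: nf)
      also have "emeasure lborel \<dots> = emeasure (distr lborel borel f) (?B \<inter> A)"
        using A by (subst emeasure_distr) auto
      also have "\<dots> = emeasure lborel (?B \<inter> A)" by (simp add: distr_lborel_orthogonal[OF f])
      also have "\<dots> / emeasure lborel ?B = emeasure N A" using A by (simp add: N_def)
      finally show "emeasure (distr N N f) A = emeasure N A" .
    qed simp
    have "distr \<sigma> \<sigma> f = distr \<sigma> ?R f" by (rule distr_cong) (auto simp: \<sigma>_def)
    also have "\<dots> = distr N ?R (f \<circ> h)" unfolding \<sigma>_def by (rule distr_distr) measurable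
    also have "\<dots> = distr N ?R (h \<circ> f)"
    proof (rule distr_cong_AE)
      have "AE x in lborel. x \<noteq> (0 :: real ^ 'p)" using AE_lborel_singleton by blast
      then have "AE x in N. x \<noteq> 0" unfolding N_def
        by (intro AE_uniform_measureI) auto
      then show "AE x in N. (f \<circ> h) x = (h \<circ> f) x"
      proof eventually_elim
        fix x :: "real ^ 'p" assume x: "x \<noteq> 0"
        then have "f x \<noteq> 0" using nf[of x] by (metis norm_eq_zero)
        then show "(f \<circ> h) x = (h \<circ> f) x"
          using x by (simp add: h_def nf linear_cmul[OF fl])
      qed
    next
      show "f \<circ> h \<in> measurable N ?R" by (rule measurable_comp[OF hN fR])
      show "h \<circ> f \<in> measurable N ?R"
        using measurable_comp[OF fm hm] measurable_cong_sets[OF sN(1) refl] by blast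
    qed (rule refl)+
    also have "\<dots> = distr (distr N N f) ?R h"
      by (rule distr_distr[symmetric]) (auto simp: measurable_cong_sets[OF sN(1) sN(1)] fm)
    finally show ?thesis by (simp add: NN \<sigma>_def)
  qed
  moreover have "prob_space \<sigma>" unfolding \<sigma>_def by (rule N.prob_space_distr) measurable
  ultimately have "sphere_haar_measure \<sigma>" by (auto simp: sphere_haar_measure_def \<sigma>_def)
  then show ?thesis ..
qed

end

theory Submission
  imports Defs
begin

text \<open>
  Everything happens at the level of a single number \<open>s = \<bar>a \<bullet> u\<bar>\<close>, which lies in \<open>[0, 1]\<close> by
  the Cauchy--Schwarz inequality. For such \<open>s\<close>, with \<open>1 / 0 = \<infinity>\<close>,
  \[ \frac1s = 1 + \int_0^1 \frac{1_{s \le t}}{t^2}\,dt, \qquad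
     \frac{w(s) + 1}{2} \le \frac1s \le w(s) + 1, \quad
     w(s) = \sum_n 2^n 1_{s \le 2^{-n}}. \]
  The first identity is the fundamental theorem of calculus for \<open>-1/t\<close>
  (\<open>inverse_layer_cake\<close>). The dyadic bounds hold because, for \<open>s > 0\<close>, \<open>w(s)\<close> is a partial
  geometric sum: \<open>w(s) + 1\<close> is the least power of two that exceeds \<open>1/s\<close>, so it is at most
  twice \<open>1/s\<close> (\<open>inverse_dyadic_bounds\<close>). For \<open>s = 0\<close> all the quantities are infinite.

  Integrating over the measure turns the indicator of \<open>s \<le> t\<close> into the measure of the band of
  width \<open>t\<close>; Tonelli's theorem justifies this for the integral and monotone convergence for the
  series. The geometry of the sphere is no longer visible here, so this is done for a
  \<open>[0, 1]\<close>-valued function on a measure space. The comparison of finiteness then holds at every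
  single \<open>u\<close>, because the total mass is finite, and almost everywhere as a consequence.
\<close>

lemma ennreal_eq_top_of_nat_bounds:
  fixes x :: ennreal
  assumes "\<And>n. of_nat n \<le> x"
  shows "x = \<infinity>"
proof (rule ccontr)
  assume "x \<noteq> \<infinity>"
  then have "x < top" by (simp add: less_top)
  then obtain n where "x < of_nat n" using ennreal_Ex_less_of_nat by auto
  then show False using assms[of n] by simp
qed

lemma nn_integral_inverse_square:
  fixes s :: real
  assumes "0 < s" "s \<le> 1"
  shows "(\<integral>\<^sup>+t. inverse (ennreal (t\<^sup>2)) * indicator {s..1} t \<partial>lborel) = ennreal (1 / s - 1)"
proof -
  have "(\<integral>\<^sup>+t. inverse (ennreal (t\<^sup>2)) * indicator {s..1} t \<partial>lborel)
      = (\<integral>\<^sup>+t. ennreal (inverse (t\<^sup>2)) * indicator {s..1} t \<partial>lborel)"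
    using assms by (intro nn_integral_cong) (auto simp: indicator_def inverse_ennreal)
  also have "\<dots> = ennreal (- inverse 1 - - inverse s)"
  proof (rule nn_integral_FTC_Icc[where F = "\<lambda>t. - inverse t"])
    fix t :: real assume "t \<in> {s..1}"
    then show "DERIV (\<lambda>t. - inverse t) t :> inverse (t\<^sup>2)"
      using assms by (auto intro!: derivative_eq_intros simp: power2_eq_square)
  qed (use assms in auto)
  finally show ?thesis by (simp add: field_simps)
qed

text \<open>
  At \<open>s = 0\<close> both sides are infinite: the integral over \<open>{0<..1}\<close> dominates the one over
  \<open>{1 / Suc n..1}\<close>, which equals \<open>n\<close>.
\<close>

lemma inverse_layer_cake:
  fixes s :: real
  assumes "0 \<le> s" "s \<le> 1"
  shows "inverse (ennreal s) =
    1 + (\<integral>\<^sup>+t. inverse (ennreal (t\<^sup>2)) * (indicator {s..} t * indicator {0<..1} t) \<partial>lborel)"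
    (is "_ = 1 + ?J s")
proof (cases "s = 0")
  case False
  with assms have s: "0 < s" by simp
  have "?J s = (\<integral>\<^sup>+t. inverse (ennreal (t\<^sup>2)) * indicator {s..1} t \<partial>lborel)"
    using s by (intro nn_integral_cong) (auto simp: indicator_def)
  also have "\<dots> = ennreal (1 / s - 1)"
    by (rule nn_integral_inverse_square) (use s assms in auto)
  finally have "1 + ?J s = ennreal 1 + ennreal (1 / s - 1)" by simp
  also have "\<dots> = ennreal (1 / s)"
    using s assms by (subst ennreal_plus[symmetric]) auto
  finally show ?thesis using s by (simp add: inverse_ennreal divide_inverse)
next
  case True
  have "of_nat n \<le> ?J 0" for n
  proof -
    have "of_nat n = ennreal (1 / (1 / real (Suc n)) - 1)"
      by (simp add: ennreal_of_nat_eq_real_of_nat)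
    also have "\<dots> = (\<integral>\<^sup>+t. inverse (ennreal (t\<^sup>2)) * indicator {1 / real (Suc n)..1} t \<partial>lborel)"
      by (rule nn_integral_inverse_square[symmetric]) auto
    also have "\<dots> \<le> ?J 0"
    proof (intro nn_integral_mono mult_left_mono)
      fix t :: real
      have "0 < 1 / real (Suc n)" by simp
      then have "0 < t" if "1 / real (Suc n) \<le> t" using that by linarith
      then show "(indicator {1 / real (Suc n)..1} t :: ennreal) \<le> indicator {0..} t * indicator {0<..1} t"
        by (auto simp: indicator_def simp del: of_nat_Suc)
    qed simp
    finally show ?thesis .
  qed
  then have "?J 0 = \<infinity>" by (rule ennreal_eq_top_of_nat_bounds)
  with True show ?thesis by simp
qed

text \<open>
  For \<open>s > 0\<close> let \<open>N\<close> be least with \<open>2\<^sup>-\<^sup>N < s\<close>. The series stops at \<open>N\<close> and has the sum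
  \<open>w = 2\<^sup>N - 1\<close>, while minimality of \<open>N\<close> gives \<open>2\<^sup>N\<^sup>-\<^sup>1 \<le> 1/s < 2\<^sup>N\<close>. For \<open>s = 0\<close> every term is
  present and the series diverges.
\<close>

lemma inverse_dyadic_bounds:
  fixes s :: real
  assumes "0 \<le> s" "s \<le> 1"
  defines "w \<equiv> (\<Sum>n. 2 ^ n * indicator {..1 / 2 ^ n} s) :: ennreal"
  shows "(w + 1) / 2 \<le> inverse (ennreal s)" and "inverse (ennreal s) \<le> w + 1"
proof -
  have "(w + 1) / 2 \<le> inverse (ennreal s) \<and> inverse (ennreal s) \<le> w + 1"
  proof (cases "s = 0")
    case True
    have "of_nat n \<le> w" for n
    proof -
      have "of_nat n \<le> (of_nat (2 ^ n) :: ennreal)"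
        using less_exp[of n] by (intro of_nat_mono) simp
      also have "\<dots> = (\<Sum>k\<in>{n}. 2 ^ k * indicator {..1 / 2 ^ k} s)" using True by simp
      also have "\<dots> \<le> w" unfolding w_def by (rule sum_le_suminf) auto
      finally show ?thesis .
    qed
    then have "w = \<infinity>" by (rule ennreal_eq_top_of_nat_bounds)
    with True show ?thesis by simp
  next
    case False
    with assms have s: "0 < s" by simp
    \<comment> \<open>\<open>N\<close> counts the nonzero terms of the series, and \<open>N > 0\<close> because \<open>s \<le> 1\<close>.\<close>
    define N where "N = (LEAST n. 1 / 2 ^ n < s)"
    obtain n where "1 / 2 ^ n < s"
      using real_arch_pow_inv[OF s, of "1 / 2"] by (auto simp: power_one_over)
    then have N: "1 / 2 ^ N < s" unfolding N_def by (rule LeastI)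
    have below: "s \<le> 1 / 2 ^ n" if "n < N" for n
      using not_less_Least[of n "\<lambda>n. 1 / 2 ^ n < s"] that by (simp add: N_def)
    have above: "\<not> s \<le> 1 / 2 ^ n" if "N \<le> n" for n
    proof -
      have "(1 :: real) / 2 ^ n \<le> 1 / 2 ^ N" using that by (simp add: field_simps)
      with N show ?thesis by simp
    qed
    have "N \<noteq> 0" using N assms by (intro notI) simp
    then obtain K where K: "N = Suc K" using not0_implies_Suc by blast
    have "w = (\<Sum>n<N. 2 ^ n * indicator {..1 / 2 ^ n} s)"
      unfolding w_def using above by (intro suminf_finite) auto
    also have "\<dots> = (\<Sum>n<N. ennreal (2 ^ n))"
      using below ennreal_power[of 2] by (intro sum.cong) auto
    also have "\<dots> = ennreal (\<Sum>n<N. 2 ^ n)" by (rule sum_ennreal) simp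
    also have "(\<Sum>n<N. 2 ^ n) = (2 ^ N - 1 :: real)" using geometric_sum[of "2 :: real" N] by simp
    finally have "w + 1 = ennreal (2 ^ N - 1) + ennreal 1" by simp
    also have "\<dots> = ennreal (2 ^ N)" by (subst ennreal_plus[symmetric]) auto
    finally have w: "w + 1 = ennreal (2 ^ N)" .
    have half: "(w + 1) / 2 = ennreal (2 ^ K)"
      using divide_ennreal[of "2 ^ N" 2] by (simp add: w K)
    have "inverse s \<le> 2 ^ N" using N s by (simp add: field_simps)
    moreover have "2 ^ K \<le> inverse s" using below[of K] K s by (simp add: field_simps)
    ultimately show ?thesis
      using s by (simp add: half) (simp add: w inverse_ennreal ennreal_leI)
  qed
  then show "(w + 1) / 2 \<le> inverse (ennreal s)" "inverse (ennreal s) \<le> w + 1" by auto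
qed

text \<open>
  Finiteness of \<open>M\<close> serves to exchange the two integrals. The kernel has to be measurable in
  the pair \<open>(x, t)\<close>, which is visible once the indicator of \<open>{f x..}\<close> at \<open>t\<close> is read as that
  of the region on and above the graph of \<open>f\<close>.
\<close>

lemma nn_integral_inverse_layer_cake:
  fixes f :: "'a \<Rightarrow> real"
  assumes "finite_measure M" and f [measurable]: "f \<in> borel_measurable M"
    and range: "\<And>x. x \<in> space M \<Longrightarrow> 0 \<le> f x \<and> f x \<le> 1"
  shows "(\<integral>\<^sup>+x. inverse (ennreal (f x)) \<partial>M) = emeasure M (space M) +
    (\<integral>\<^sup>+t \<in> {0<..1}. (emeasure M {x \<in> space M. f x \<le> t} / ennreal (t\<^sup>2)) \<partial>lborel)"
proof -
  interpret finite_measure M by fact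
  interpret pair_sigma_finite M lborel ..
  let ?k = "\<lambda>x t. inverse (ennreal (t\<^sup>2)) * (indicator {f x..} t * indicator {0<..1} t)"
  have k [measurable]: "case_prod ?k \<in> borel_measurable (M \<Otimes>\<^sub>M lborel)"
  proof -
    have "case_prod ?k = (\<lambda>p. inverse (ennreal ((snd p)\<^sup>2)) *
        (indicator {p. f (fst p) \<le> snd p} p * indicator {0<..1} (snd p)))"
      by (auto simp: fun_eq_iff indicator_def)
    also have "\<dots> \<in> borel_measurable (M \<Otimes>\<^sub>M lborel)" by measurable
    finally show ?thesis .
  qed
  have "(\<integral>\<^sup>+x. inverse (ennreal (f x)) \<partial>M) = (\<integral>\<^sup>+x. 1 + (\<integral>\<^sup>+t. ?k x t \<partial>lborel) \<partial>M)"
    using range by (intro nn_integral_cong inverse_layer_cake) auto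
  also have "\<dots> = emeasure M (space M) + (\<integral>\<^sup>+x. (\<integral>\<^sup>+t. ?k x t \<partial>lborel) \<partial>M)"
    using lborel.borel_measurable_nn_integral[OF k] by (subst nn_integral_add) auto
  also have "(\<integral>\<^sup>+x. (\<integral>\<^sup>+t. ?k x t \<partial>lborel) \<partial>M) = (\<integral>\<^sup>+t. (\<integral>\<^sup>+x. ?k x t \<partial>M) \<partial>lborel)"
    using Fubini'[OF k] by simp
  also have "\<dots> = (\<integral>\<^sup>+t \<in> {0<..1}. (emeasure M {x \<in> space M. f x \<le> t} / ennreal (t\<^sup>2)) \<partial>lborel)"
  proof (intro nn_integral_cong)
    fix t :: real
    have "(\<integral>\<^sup>+x. ?k x t \<partial>M) = (\<integral>\<^sup>+x. (inverse (ennreal (t\<^sup>2)) * indicator {0<..1} t) *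
        indicator {x \<in> space M. f x \<le> t} x \<partial>M)"
      by (intro nn_integral_cong) (auto simp: indicator_def)
    also have "\<dots> = (inverse (ennreal (t\<^sup>2)) * indicator {0<..1} t) *
        emeasure M {x \<in> space M. f x \<le> t}"
      by (rule nn_integral_cmult_indicator) measurable
    finally show "(\<integral>\<^sup>+x. ?k x t \<partial>M) =
        emeasure M {x \<in> space M. f x \<le> t} / ennreal (t\<^sup>2) * indicator {0<..1} t"
      by (simp add: divide_ennreal_def mult_ac)
  qed
  finally show ?thesis .
qed

lemma nn_integral_inverse_dyadic_bounds:
  fixes f :: "'a \<Rightarrow> real"
  assumes f [measurable]: "f \<in> borel_measurable M"
    and range: "\<And>x. x \<in> space M \<Longrightarrow> 0 \<le> f x \<and> f x \<le> 1"
  defines "W \<equiv> (\<Sum>n. 2 ^ n * emeasure M {x \<in> space M. f x \<le> 1 / 2 ^ n})"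
  shows "(W + emeasure M (space M)) / 2 \<le> (\<integral>\<^sup>+x. inverse (ennreal (f x)) \<partial>M)"
    and "(\<integral>\<^sup>+x. inverse (ennreal (f x)) \<partial>M) \<le> W + emeasure M (space M)"
proof -
  define w where "w = (\<lambda>s :: real. (\<Sum>n. 2 ^ n * indicator {..1 / 2 ^ n} s) :: ennreal)"
  have w [measurable]: "w \<in> borel_measurable borel" unfolding w_def by measurable
  have "(\<integral>\<^sup>+x. w (f x) \<partial>M) = (\<Sum>n. \<integral>\<^sup>+x. 2 ^ n * indicator {..1 / 2 ^ n} (f x) \<partial>M)"
    unfolding w_def by (rule nn_integral_suminf) measurable
  also have "\<dots> = W"
    unfolding W_def
  proof (rule suminf_cong)
    fix n
    have "(\<integral>\<^sup>+x. 2 ^ n * indicator {..1 / 2 ^ n} (f x) \<partial>M) =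
        (\<integral>\<^sup>+x. 2 ^ n * indicator {x \<in> space M. f x \<le> 1 / 2 ^ n} x \<partial>M)"
      by (intro nn_integral_cong) (auto simp: indicator_def)
    also have "\<dots> = 2 ^ n * emeasure M {x \<in> space M. f x \<le> 1 / 2 ^ n}"
      by (rule nn_integral_cmult_indicator) measurable
    finally show "(\<integral>\<^sup>+x. 2 ^ n * indicator {..1 / 2 ^ n} (f x) \<partial>M) =
        2 ^ n * emeasure M {x \<in> space M. f x \<le> 1 / 2 ^ n}" .
  qed
  finally have W: "(\<integral>\<^sup>+x. w (f x) + 1 \<partial>M) = W + emeasure M (space M)"
    by (subst nn_integral_add) auto
  have "(W + emeasure M (space M)) / 2 = (\<integral>\<^sup>+x. (w (f x) + 1) / 2 \<partial>M)"
    by (subst W[symmetric], rule nn_integral_divide[symmetric]) measurable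
  also have "\<dots> \<le> (\<integral>\<^sup>+x. inverse (ennreal (f x)) \<partial>M)"
    unfolding w_def using range by (intro nn_integral_mono inverse_dyadic_bounds) auto
  finally show "(W + emeasure M (space M)) / 2 \<le> (\<integral>\<^sup>+x. inverse (ennreal (f x)) \<partial>M)" .
  have "(\<integral>\<^sup>+x. inverse (ennreal (f x)) \<partial>M) \<le> (\<integral>\<^sup>+x. w (f x) + 1 \<partial>M)"
    unfolding w_def using range by (intro nn_integral_mono inverse_dyadic_bounds) auto
  then show "(\<integral>\<^sup>+x. inverse (ennreal (f x)) \<partial>M) \<le> W + emeasure M (space M)" by (simp only: W)
qed

theorem theorem8p1:
  fixes \<mu> :: "(real ^ 'p) measure"
  assumes "CARD('p) \<ge> 2"
    and "finite_borel_measure_on_sphere \<mu>"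
  shows "(\<forall>u \<in> unit_sphere.
            I_int \<mu> u = emeasure \<mu> unit_sphere
              + (\<integral>\<^sup>+ t \<in> {0<..1}. (band \<mu> u t / ennreal (t\<^sup>2)) \<partial>lborel) \<and>
            (W_sum \<mu> u + emeasure \<mu> unit_sphere) / 2 \<le> I_int \<mu> u \<and>
            I_int \<mu> u \<le> W_sum \<mu> u + emeasure \<mu> unit_sphere) \<and>
         (\<forall>\<sigma>. sphere_haar_measure \<sigma> \<longrightarrow>
            ((AE u in \<sigma>. I_int \<mu> u < \<infinity>) \<longleftrightarrow> (AE u in \<sigma>. W_sum \<mu> u < \<infinity>)))"
proof (intro conjI ballI allI impI)
  have sets: "sets \<mu> = sets (restrict_space borel unit_sphere)" and fin: "finite_measure \<mu>"
    using assms(2) by (auto simp: finite_borel_measure_on_sphere_def)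
  have space: "space \<mu> = unit_sphere"
    using sets_eq_imp_space_eq[OF sets] by (simp add: space_restrict_space)
  have meas: "(\<lambda>a. \<bar>a \<bullet> u\<bar>) \<in> borel_measurable \<mu>" for u
    by (subst measurable_cong_sets[OF sets refl], rule measurable_restrict_space1) measurable
  have range: "0 \<le> \<bar>a \<bullet> u\<bar> \<and> \<bar>a \<bullet> u\<bar> \<le> 1" if "u \<in> unit_sphere" "a \<in> space \<mu>" for u a
    using Cauchy_Schwarz_ineq2[of a u] that by (simp add: space)
  have I: "I_int \<mu> u = (\<integral>\<^sup>+a. inverse (ennreal \<bar>a \<bullet> u\<bar>) \<partial>\<mu>)" for u
    unfolding I_int_def by (intro nn_integral_cong) (auto simp: inverse_ennreal divide_inverse)
  note band = band_def space[symmetric]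
  show "I_int \<mu> u = emeasure \<mu> unit_sphere
      + (\<integral>\<^sup>+ t \<in> {0<..1}. (band \<mu> u t / ennreal (t\<^sup>2)) \<partial>lborel)" if "u \<in> unit_sphere" for u
    unfolding I band by (rule nn_integral_inverse_layer_cake[OF fin meas range[OF that]])
  show lower: "(W_sum \<mu> u + emeasure \<mu> unit_sphere) / 2 \<le> I_int \<mu> u" if "u \<in> unit_sphere" for u
    unfolding I W_sum_def band by (rule nn_integral_inverse_dyadic_bounds(1)[OF meas range[OF that]])
  show upper: "I_int \<mu> u \<le> W_sum \<mu> u + emeasure \<mu> unit_sphere" if "u \<in> unit_sphere" for u
    unfolding I W_sum_def band by (rule nn_integral_inverse_dyadic_bounds(2)[OF meas range[OF that]])
  fix \<sigma> :: "(real ^ 'p) measure"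
  assume "sphere_haar_measure \<sigma>"
  then have "space \<sigma> = unit_sphere"
    using sets_eq_imp_space_eq[of \<sigma> "restrict_space borel unit_sphere"]
    by (simp add: sphere_haar_measure_def space_restrict_space)
  moreover have "I_int \<mu> u < \<infinity> \<longleftrightarrow> W_sum \<mu> u < \<infinity>" if u: "u \<in> unit_sphere" for u
  proof
    assume "W_sum \<mu> u < \<infinity>"
    moreover have "emeasure \<mu> unit_sphere < \<infinity>"
      using finite_measure.emeasure_finite[OF fin] by (simp add: less_top)
    ultimately show "I_int \<mu> u < \<infinity>"
      using upper[OF u] by (simp add: le_less_trans)
  next
    assume "I_int \<mu> u < \<infinity>"
    then have "(W_sum \<mu> u + emeasure \<mu> unit_sphere) / 2 < \<infinity>"
      using lower[OF u] by (rule le_less_trans[rotated])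
    then show "W_sum \<mu> u < \<infinity>"
      by (auto simp: ennreal_divide_eq_top_iff less_top[symmetric])
  qed
  ultimately show "(AE u in \<sigma>. I_int \<mu> u < \<infinity>) \<longleftrightarrow> (AE u in \<sigma>. W_sum \<mu> u < \<infinity>)"
    by (intro AE_cong) simp
qed

end
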